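(* For every $\Sigma\in\operatorname{Sym}^{++}(n)$ and all $U,V\in\operatorname{Sym}(n)$, $$W_\Sigma(U,V)=\frac12\left\langle \mathcal L_\Sigma[U],V\right\rangle\equiv\left\langle \mathcal L_\Sigma[U],V\right\rangle_2 .$$
   Context: $\operatorname{Sym}(n)$ is the space of real symmetric $n\times n$ matrices and $\operatorname{Sym}^{++}(n)$ the open cone of positive-definite ones. $\langle A,B\rangle=\operatorname{Tr}(AB^* )$ is the Frobenius inner product and, on $\operatorname{Sym}(n)$, $\langle A,B\rangle_2=\frac12\operatorname{Tr}(AB)$. For $\Sigma\in\operatorname{Sym}^{++}(n)$ and $V\in\operatorname{Sym}(n)$, $\mathcal L_\Sigma[V]$ denotes the unique $X\in\operatorname{Sym}(n)$ with $X\Sigma+\Sigma X=V$. The Wasserstein Riemannian metric on $\operatorname{Sym}^{++}(n)$ is $W_\Sigma(U,V)=\operatorname{Tr}\left(\mathcal L_\Sigma[U]\,\Sigma\,\mathcal L_\Sigma[V]\right)$. *)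

theory Defs
  imports "HOL-Analysis.Analysis"
begin

definition Sym :: "(real^'n^'n) set"
  where "Sym = {A. transpose A = A}"

definition Sym_pd :: "(real^'n^'n) set"
  where "Sym_pd = {A \<in> Sym. \<forall>x. x \<noteq> 0 \<longrightarrow> 0 < x \<bullet> (A *v x)}"

text \<open>All matrices are real, so the adjoint in the Frobenius inner product is the transpose.\<close>

definition frobenius :: "real^'n^'n \<Rightarrow> real^'n^'n \<Rightarrow> real"
  where "frobenius A B = trace (A ** transpose B)"

definition inner2 :: "real^'n^'n \<Rightarrow> real^'n^'n \<Rightarrow> real"
  where "inner2 A B = (1/2) * trace (A ** B)"

text \<open>The definite description is proper for positive-definite \<open>S\<close> and symmetric \<open>V\<close>;
  see \<open>lyapunov_ex1\<close> below.\<close>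

definition lyapunov :: "real^'n^'n \<Rightarrow> real^'n^'n \<Rightarrow> real^'n^'n"
  where "lyapunov S V = (THE X. X \<in> Sym \<and> X ** S + S ** X = V)"

definition wasserstein_metric :: "real^'n^'n \<Rightarrow> real^'n^'n \<Rightarrow> real^'n^'n \<Rightarrow> real"
  where "wasserstein_metric S U V = trace (lyapunov S U ** S ** lyapunov S V)"

lemma trace_quadratic_form:
  fixes S X :: "real^'n^'n"
  shows "trace (X ** S ** transpose X) = (\<Sum>i\<in>UNIV. (X $ i) \<bullet> (S *v (X $ i)))"
proof -
  have "(X ** S ** transpose X) $ i $ i = (X $ i) \<bullet> (S *v (X $ i))" for i
    unfolding matrix_mul_assoc [symmetric]
    by (simp add: matrix_matrix_mult_def matrix_vector_mult_def transpose_def inner_vec_def)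
  then show ?thesis by (simp add: trace_def)
qed

lemma trace_quadratic_form_pd:
  fixes S X :: "real^'n^'n"
  assumes "S \<in> Sym_pd"
  shows "0 \<le> trace (X ** S ** transpose X)"
    and "trace (X ** S ** transpose X) = 0 \<Longrightarrow> X = 0"
proof -
  have pos: "0 < x \<bullet> (S *v x)" if "x \<noteq> 0" for x
    using assms that by (simp add: Sym_pd_def)
  have nn: "0 \<le> x \<bullet> (S *v x)" for x
    using pos[of x] by (cases "x = 0") auto
  show "0 \<le> trace (X ** S ** transpose X)"
    unfolding trace_quadratic_form by (intro sum_nonneg nn)
  assume "trace (X ** S ** transpose X) = 0"
  then have "\<forall>i. (X $ i) \<bullet> (S *v (X $ i)) = 0"
    unfolding trace_quadratic_form by (subst (asm) sum_nonneg_eq_0_iff) (auto intro: nn)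
  then have "\<forall>i. X $ i = 0" using pos by (metis less_irrefl)
  then show "X = 0" by (simp add: vec_eq_iff)
qed

lemma lyapunov_ex1:
  fixes S V :: "real^'n^'n"
  assumes S: "S \<in> Sym_pd" and V: "V \<in> Sym"
  shows "\<exists>!X. X \<in> Sym \<and> X ** S + S ** X = V"
proof -
  define F where "F = (\<lambda>X::real^'n^'n. X ** S + S ** X)"
  have ST: "transpose S = S" using S by (simp add: Sym_pd_def Sym_def)
  have lin: "linear F"
    unfolding F_def
    by (intro linearI)
       (simp_all add: matrix_matrix_mult_def vec_eq_iff distrib_left distrib_right sum.distrib
          sum_distrib_left mult.assoc mult.left_commute)
  have ker: "X = 0" if "F X = 0" for X
  proof -
    have "trace (X ** S ** transpose X) = trace (transpose X ** (X ** S))"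
      by (rule trace_mul_sym)
    then have "trace (X ** S ** transpose X) + trace (transpose X ** S ** X) = trace (transpose X ** F X)"
      unfolding F_def matrix_add_ldistrib trace_add by (simp only: matrix_mul_assoc)
    also have "\<dots> = 0" using that by (simp add: trace_def)
    finally show ?thesis
      using trace_quadratic_form_pd(1)[OF S, of "transpose X"] trace_quadratic_form_pd[OF S, of X]
      by simp
  qed
  then have inj: "inj F" using lin by (simp add: linear_injective_0)
  then have "surj F" using lin by (simp add: linear_injective_imp_surjective)
  then obtain X where X: "F X = V" by (metis surjD)
  have "transpose (A + B) = transpose A + transpose B" for A B :: "real^'n^'n"
    by (simp add: transpose_def vec_eq_iff)
  then have "transpose (F X) = F (transpose X)"
    by (simp add: F_def matrix_transpose_mul ST add.commute)
  then have "F (transpose X) = F X" using V X by (simp add: Sym_def)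
  then have "transpose X = X" using inj by (simp add: inj_eq)
  then have "X \<in> Sym" by (simp add: Sym_def)
  moreover have "Y = X" if "Y ** S + S ** Y = V" for Y
    using that X injD[OF inj, of Y X] by (simp add: F_def)
  ultimately show ?thesis using X unfolding F_def by blast
qed

end

theory Submission
  imports Defs
begin

text \<open>
  Write \<open>X\<close> and \<open>Y\<close> for the Lyapunov solutions belonging to \<open>U\<close> and \<open>V\<close>. Substituting
  \<open>V = Y S + S Y\<close> gives \<open>Tr (X V) = Tr (X Y S) + Tr (X S Y)\<close>. The two words \<open>X Y S\<close> and
  \<open>X S Y\<close> are, up to cyclic rotation, reversals of each other, and reversing a word of symmetric
  matrices means transposing it. So both traces agree with \<open>W\<^sub>S(U, V)\<close>, which is therefore half
  of \<open>Tr (X V)\<close>. The second equality only expresses that \<open>V\<close> is its own transpose.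
\<close>

lemma lyapunov_solves:
  fixes S V :: "real^'n^'n"
  assumes "S \<in> Sym_pd" and "V \<in> Sym"
  shows "lyapunov S V \<in> Sym"
    and "lyapunov S V ** S + S ** lyapunov S V = V"
  using theI'[OF lyapunov_ex1[OF assms]] unfolding lyapunov_def by blast+

lemma trace_mul_commute_right_Sym:
  fixes A B C :: "real^'n^'n"
  assumes "A \<in> Sym" and "B \<in> Sym" and "C \<in> Sym"
  shows "trace (A ** (B ** C)) = trace (A ** (C ** B))"
proof -
  have "trace (A ** (B ** C)) = trace (transpose (A ** (B ** C)))"
    by (simp add: trace_def transpose_def)
  also have "transpose (A ** (B ** C)) = (C ** B) ** A"
    using assms by (simp add: Sym_def matrix_transpose_mul)
  also have "trace \<dots> = trace (A ** (C ** B))"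
    by (rule trace_mul_sym)
  finally show ?thesis .
qed

theorem proposition7:
  fixes S U V :: "real^'n^'n"
  assumes "S \<in> Sym_pd" and "U \<in> Sym" and "V \<in> Sym"
  shows "wasserstein_metric S U V = (1/2) * frobenius (lyapunov S U) V
       \<and> (1/2) * frobenius (lyapunov S U) V = inner2 (lyapunov S U) V"
proof -
  let ?X = "lyapunov S U" and ?Y = "lyapunov S V"
  have S: "S \<in> Sym" using assms(1) by (simp add: Sym_pd_def)
  note X = lyapunov_solves(1)[OF assms(1,2)]
  note Y = lyapunov_solves[OF assms(1,3)]
  have frob: "frobenius ?X V = trace (?X ** V)"
    using assms(3) by (simp add: frobenius_def Sym_def)
  have "trace (?X ** V) = trace (?X ** (?Y ** S + S ** ?Y))"
    by (simp only: Y(2))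
  also have "\<dots> = trace (?X ** (?Y ** S)) + trace (?X ** (S ** ?Y))"
    by (simp only: matrix_add_ldistrib trace_add)
  also have "\<dots> = 2 * trace (?X ** (S ** ?Y))"
    by (simp add: trace_mul_commute_right_Sym[OF X Y(1) S])
  also have "\<dots> = 2 * wasserstein_metric S U V"
    by (simp add: wasserstein_metric_def matrix_mul_assoc)
  finally show ?thesis
    by (simp add: frob inner2_def)
qed

end
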